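(* A generating function for the family $P^{(1/2)}_{m,n}$ is $$G(X,Y)=\frac{1-XY}{(1-3XZ+3X^2\bar Z-X^3)(1-3Y\bar Z+3Y^2Z-Y^3)},$$ that is, there are nonzero constants $c_{m,n}$ such that, as formal power series in $X,Y$, $G(X,Y)=\sum_{m,n\ge0}c_{m,n}\,P^{(1/2)}_{m,n}(Z,\bar Z)\,X^mY^n$.
   Context: $Z,\bar Z$ are treated as two independent variables (conjugate complex coordinates). For $\alpha>-5/6$ and $\lambda=\frac12(6\alpha+5)$ (so $\lambda=4$ when $\alpha=\frac12$), the polynomials $P_{p,q}=P^{(\alpha)}_{p,q}(Z,\bar Z)$, $p,q\ge0$, are defined inductively by $P_{0,0}=1$, $P_{0,1}=\bar Z$, $P_{1,0}=Z$ and $$P_{p+1,q}=Z P_{p,q}+a_1(\lambda,p)P_{p-1,q+1}+a_2(\lambda,p,q)P_{p,q-1},\quad P_{p,q+1}=\bar Z P_{p,q}+a_1(\lambda,q)P_{p+1,q-1}+a_2(\lambda,q,p)P_{p-1,q},$$ where $$a_1(\lambda,p)=-\frac{p(3p+2\lambda-5)}{(\lambda+3p-1)(\lambda+3p-4)},\quad a_2(\lambda,p,q)=-\frac{q(3q+2\lambda-5)(\lambda+3(p+q)-1)(\lambda+p+q-2)}{(\lambda+3q-1)(2\lambda+3(p+q)-5)(2\lambda+3(p+q)-2)(\lambda+3q-4)},$$ with $a_1(\lambda,0)=a_2(\lambda,p,0)=0$ and, when a denominator vanishes, the value being the limit as $\epsilon\to0$ of the same expression at $\lambda+\epsilon$.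 (For $\lambda=4$ this gives $a_1(4,p)=-\frac13$ for $p\ge1$ and $a_2(4,p,q)=-\frac19$ for $q\ge1$.) *)

theory Defs
  imports
    Complex_Main
    "HOL-Computational_Algebra.Computational_Algebra"
begin

(* Polynomials in the two independent variables Z and conj Z are elements of real poly poly:
   Z is the inner variable, conj Z the outer one. *)

type_synonym bipoly = "real poly poly"

definition varZ :: bipoly where
  "varZ = [:[:0, 1:]:]"

definition varZbar :: bipoly where
  "varZbar = [:0, 1:]"

definition bconst :: "real \<Rightarrow> bipoly" where
  "bconst c = [:[:c:]:]"

definition lam :: "real \<Rightarrow> real" where
  "lam \<alpha> = (6 * \<alpha> + 5) / 2"

definition num1 :: "real \<Rightarrow> nat \<Rightarrow> real" where
  "num1 l p = real p * (3 * real p + 2 * l - 5)"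

definition den1 :: "real \<Rightarrow> nat \<Rightarrow> real" where
  "den1 l p = (l + 3 * real p - 1) * (l + 3 * real p - 4)"

definition coef1 :: "real \<Rightarrow> nat \<Rightarrow> real" where
  "coef1 l p =
    (if p = 0 then 0
     else if den1 l p = 0 then Lim (at 0) (\<lambda>\<epsilon>. - (num1 (l + \<epsilon>) p / den1 (l + \<epsilon>) p))
     else - (num1 l p / den1 l p))"

definition num2 :: "real \<Rightarrow> nat \<Rightarrow> nat \<Rightarrow> real" where
  "num2 l p q = real q * (3 * real q + 2 * l - 5) * (l + 3 * (real p + real q) - 1)
     * (l + real p + real q - 2)"

definition den2 :: "real \<Rightarrow> nat \<Rightarrow> nat \<Rightarrow> real" where
  "den2 l p q = (l + 3 * real q - 1) * (2 * l + 3 * (real p + real q) - 5)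
     * (2 * l + 3 * (real p + real q) - 2) * (l + 3 * real q - 4)"

definition coef2 :: "real \<Rightarrow> nat \<Rightarrow> nat \<Rightarrow> real" where
  "coef2 l p q =
    (if q = 0 then 0
     else if den2 l p q = 0 then Lim (at 0) (\<lambda>\<epsilon>. - (num2 (l + \<epsilon>) p q / den2 (l + \<epsilon>) p q))
     else - (num2 l p q / den2 l p q))"

(* At p = 0 or q = 0 the truncated indices p - 1, q - 1 occur only multiplied by
   coef1 l 0 = 0 or coef2 l _ 0 = 0, so the corresponding terms are absent. *)

definition recursive_family :: "real \<Rightarrow> (nat \<Rightarrow> nat \<Rightarrow> bipoly) \<Rightarrow> bool" where
  "recursive_family \<alpha> P \<longleftrightarrow>
     P 0 0 = 1 \<and> P 0 1 = varZbar \<and> P 1 0 = varZ \<and>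
     (\<forall>p q. P (p + 1) q = varZ * P p q
              + bconst (coef1 (lam \<alpha>) p) * P (p - 1) (q + 1)
              + bconst (coef2 (lam \<alpha>) p q) * P p (q - 1)) \<and>
     (\<forall>p q. P p (q + 1) = varZbar * P p q
              + bconst (coef1 (lam \<alpha>) q) * P (p + 1) (q - 1)
              + bconst (coef2 (lam \<alpha>) q p) * P (p - 1) q)"

(* The two recursions overdetermine the family, hence a definite description rather than a
   recursive function. The intended parameter range is \<alpha> > -5/6. *)

definition Pfam :: "real \<Rightarrow> nat \<Rightarrow> nat \<Rightarrow> bipoly" where
  "Pfam \<alpha> = (THE P. recursive_family \<alpha> P)"

(* Series in X, Y over bipoly: Y is the outer and X the inner series variable, so the
   coefficient of X^m Y^n in F is F $ n $ m. *)

type_synonym biseries = "bipoly fps fps"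

definition serX :: biseries where
  "serX = fps_const fps_X"

definition serY :: biseries where
  "serY = fps_X"

definition ser_const :: "bipoly \<Rightarrow> biseries" where
  "ser_const f = fps_const (fps_const f)"

definition gen_denom :: biseries where
  "gen_denom =
     (1 - 3 * serX * ser_const varZ + 3 * serX ^ 2 * ser_const varZbar - serX ^ 3) *
     (1 - 3 * serY * ser_const varZbar + 3 * serY ^ 2 * ser_const varZ - serY ^ 3)"

(* bipoly is not a field, so the division on fps is not available; a series with constant
   coefficient 1 is nevertheless a unit, and its inverse is taken in each series variable. *)

definition gen_denom_inv :: biseries where
  "gen_denom_inv = fps_right_inverse gen_denom (fps_right_inverse (gen_denom $ 0) 1)"

lemma gen_denom_inv: "gen_denom * gen_denom_inv = 1"
proof -
  have "gen_denom $ 0 $ 0 = 1"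
    by (simp add: gen_denom_def serX_def serY_def ser_const_def fps_mult_nth_0 fps_power_zeroth
        numeral_fps_const)
  then have "gen_denom $ 0 * fps_right_inverse (gen_denom $ 0) 1 = 1"
    by (intro fps_right_inverse) simp
  then show ?thesis
    unfolding gen_denom_inv_def by (rule fps_right_inverse)
qed

definition genG :: biseries where
  "genG = (1 - serX * serY) * gen_denom_inv"

end

(* At lambda = 4 the recursion coefficients are constant, so Q(p,q) = 3^(p+q) P(p,q) satisfies
   x Q(p,q) = Q(p+1,q) + Q(p-1,q+1) + Q(p,q-1) with x = 3Z, y = 3 conj Z, together with the mirror
   relation: this is the Pieri rule for the characters of SU(3).  Its solution is
   Q(m,n) = h(m) k(n) - h(m-1) k(n-1), where h and k are the coefficient sequences of the
   reciprocals of 1 - xX + yX^2 - X^3 and 1 - yY + xY^2 - Y^3, so the factor 1 - XY of the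
   generating function accounts exactly for the second product. *)

theory Submission
  imports Defs
begin

(* hom_sym a b (m + 2) is the complete homogeneous symmetric polynomial of degree m in three
   variables with elementary symmetric functions a, b, 1; the shift by 2 makes room for the
   vanishing values in degrees -2 and -1. *)
fun hom_sym :: "'a::comm_ring_1 \<Rightarrow> 'a \<Rightarrow> nat \<Rightarrow> 'a" where
  "hom_sym a b 0 = 0"
| "hom_sym a b (Suc 0) = 0"
| "hom_sym a b (Suc (Suc 0)) = 1"
| "hom_sym a b (Suc (Suc (Suc n))) =
     a * hom_sym a b (Suc (Suc n)) - b * hom_sym a b (Suc n) + hom_sym a b n"

definition hom_fps :: "'a::comm_ring_1 \<Rightarrow> 'a \<Rightarrow> 'a fps" where
  "hom_fps a b = Abs_fps (\<lambda>n. hom_sym a b (n + 2))"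

text \<open>Coefficient by coefficient this is the recurrence of \<open>hom_sym\<close>; it also
  covers degrees 1 and 2 because the values in degrees -2 and -1 vanish.\<close>

lemma hom_fps_mult:
  "(1 - fps_X * fps_const a + fps_X ^ 2 * fps_const b - fps_X ^ 3) * hom_fps a b = 1"
  (is "?D * _ = _")
proof (rule fps_ext)
  fix n :: nat
  have "?D * hom_fps a b = hom_fps a b - fps_X * (fps_const a * hom_fps a b)
      + fps_X ^ 2 * (fps_const b * hom_fps a b) - fps_X ^ 3 * hom_fps a b"
    by (simp add: algebra_simps)
  then have nth: "(?D * hom_fps a b) $ n = hom_fps a b $ n
      - (if n = 0 then 0 else a * hom_fps a b $ (n - 1))
      + (if n < 2 then 0 else b * hom_fps a b $ (n - 2))
      - (if n < 3 then 0 else hom_fps a b $ (n - 3))"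
    by (simp add: fps_X_power_mult_nth)
  consider "n = 0" | "n = 1" | "n = 2" | k where "n = Suc (Suc (Suc k))"
    by atomize_elim presburger
  then show "(?D * hom_fps a b) $ n = 1 $ n"
    unfolding nth by cases (simp_all add: hom_fps_def numeral_2_eq_2 numeral_3_eq_3)
qed

text \<open>The factor in Y is a series over series in X, so its parameters occur as constant
  series.\<close>

lemma hom_sym_fps_const: "hom_sym (fps_const a) (fps_const b) n = fps_const (hom_sym a b n)"
  by (induction a b n rule: hom_sym.induct)
    (simp_all flip: fps_const_add fps_const_sub fps_const_mult)

text \<open>The irreducible SU(3) character of highest weight (m, n), where a and b are the
  characters of the standard representation and its dual. Subtracting the second product removes the
  lower constituents of Sym^m tensor dual Sym^n.\<close>

definition su3_char :: "'a::comm_ring_1 \<Rightarrow> 'a \<Rightarrow> nat \<Rightarrow> nat \<Rightarrow> 'a" where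
  "su3_char a b m n = hom_sym a b (m + 2) * hom_sym b a (n + 2)
     - hom_sym a b (m + 1) * hom_sym b a (n + 1)"

lemma su3_char_swap: "su3_char a b m n = su3_char b a n m"
  by (simp add: su3_char_def mult.commute)

text \<open>Everything cancels once \<open>hom_sym a b (p + 3)\<close> and
  \<open>hom_sym b a (q + 3)\<close> are expanded. The zero cases stand for characters with an index
  -1, which vanish.\<close>

lemma su3_char_Suc:
  "su3_char a b (Suc p) q = a * su3_char a b p q
     - (if p = 0 then 0 else su3_char a b (p - 1) (Suc q))
     - (if q = 0 then 0 else su3_char a b p (q - 1))"
  by (cases p; cases q) (simp_all add: su3_char_def algebra_simps)

lemma su3_char_Suc_right:
  "su3_char a b p (Suc q) = b * su3_char a b p q
     - (if q = 0 then 0 else su3_char a b (Suc p) (q - 1))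
     - (if p = 0 then 0 else su3_char a b (p - 1) q)"
  using su3_char_Suc[of b a q p] by (simp only: su3_char_swap[of b a])

lemma genG_nth: "genG $ n $ m = su3_char (bconst 3 * varZ) (bconst 3 * varZbar) m n"
proof -
  let ?x = "bconst 3 * varZ" and ?y = "bconst 3 * varZbar"
  \<comment> \<open>The reciprocals of the two factors; \<open>FX\<close> is constant in the outer
    variable Y.\<close>
  define FX FY :: biseries where "FX = fps_const (hom_fps ?x ?y)"
    and "FY = hom_fps (fps_const ?y) (fps_const ?x)"
  have three: "3 * ser_const f = fps_const (fps_const (bconst 3 * f))" for f
  proof -
    have "bconst 3 = 3"
      by (simp add: bconst_def numeral_poly)
    then show ?thesis
      by (simp add: ser_const_def numeral_fps_const)
  qed
  have X: "(1 - 3 * serX * ser_const varZ + 3 * serX ^ 2 * ser_const varZbar - serX ^ 3) * FX = 1"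
  proof -
    have "1 - 3 * serX * ser_const varZ + 3 * serX ^ 2 * ser_const varZbar - serX ^ 3
        = 1 - serX * (3 * ser_const varZ) + serX ^ 2 * (3 * ser_const varZbar) - serX ^ 3"
      by (simp add: algebra_simps)
    also have "\<dots> = fps_const (1 - fps_X * fps_const ?x + fps_X ^ 2 * fps_const ?y - fps_X ^ 3)"
      unfolding three serX_def
      by (simp flip: fps_const_add fps_const_sub fps_const_mult fps_const_power)
    finally show ?thesis
      by (simp add: FX_def hom_fps_mult)
  qed
  have Y: "(1 - 3 * serY * ser_const varZbar + 3 * serY ^ 2 * ser_const varZ - serY ^ 3) * FY = 1"
  proof -
    have "1 - 3 * serY * ser_const varZbar + 3 * serY ^ 2 * ser_const varZ - serY ^ 3
        = 1 - serY * (3 * ser_const varZbar) + serY ^ 2 * (3 * ser_const varZ) - serY ^ 3"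
      by (simp add: algebra_simps)
    then show ?thesis
      unfolding three serY_def by (simp only: FY_def hom_fps_mult)
  qed
  have "gen_denom * (FX * FY) = 1"
    using arg_cong2[OF X Y, of "(*)"] by (simp only: gen_denom_def mult_1_left ac_simps)
  then have "gen_denom_inv = gen_denom_inv * (gen_denom * (FX * FY))"
    by (simp only: mult_1_right)
  also have "\<dots> = gen_denom * gen_denom_inv * (FX * FY)"
    by (simp only: ac_simps)
  also have "\<dots> = FX * FY"
    by (simp only: gen_denom_inv mult_1_left)
  finally have "genG = (1 - serX * serY) * (FX * FY)"
    by (simp only: genG_def)
  also have "\<dots> = FX * FY - serY * (serX * FX * FY)"
    by (simp add: algebra_simps)
  finally have G: "genG = FX * FY - serY * (serX * FX * FY)" .
  have "(FX * FY) $ n $ m = hom_sym ?x ?y (m + 2) * hom_sym ?y ?x (n + 2)"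
    by (simp add: FX_def FY_def hom_fps_def hom_sym_fps_const)
  \<comment> \<open>The factor XY lowers both indices by one; for m = 0 or n = 0 both sides are 0,
    since \<open>hom_sym\<close> vanishes at 1.\<close>
  moreover have "(serY * (serX * FX * FY)) $ n $ m
      = hom_sym ?x ?y (m + 1) * hom_sym ?y ?x (n + 1)"
    by (cases n; cases m)
      (simp_all add: serX_def serY_def FX_def FY_def hom_fps_def hom_sym_fps_const mult.assoc)
  ultimately show ?thesis
    unfolding G by (simp only: su3_char_def fps_sub_nth)
qed

lemma coef1_half: "coef1 (lam (1/2)) p = (if p = 0 then 0 else - 1 / 3)"
proof (cases "p = 0")
  case False
  \<comment> \<open>The common factor of numerator and denominator at lambda = 4; its positivity
    rules out the limit branch of \<open>coef1\<close>.\<close>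
  define t where "t = real p * (real p + 1)"
  have "num1 4 p = 3 * t" "den1 4 p = 9 * t"
    by (simp_all add: num1_def den1_def t_def algebra_simps)
  moreover have "t > 0"
    using False by (simp add: t_def)
  ultimately show ?thesis
    using False by (simp add: coef1_def lam_def)
qed (simp add: coef1_def)

lemma coef2_half: "coef2 (lam (1/2)) p q = (if q = 0 then 0 else - 1 / 9)"
proof (cases "q = 0")
  case False
  \<comment> \<open>Two factors 3 split off above and four below, hence 9/81.\<close>
  define t where "t = real q * (real q + 1) * (real p + real q + 1) * (real p + real q + 2)"
  have "num2 4 p q = 9 * t" "den2 4 p q = 81 * t"
    by (simp_all add: num2_def den2_def t_def algebra_simps)
  moreover have "t > 0"
    using False by (simp add: t_def add_nonneg_pos)
  ultimately show ?thesis
    using False by (simp add: coef2_def lam_def)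
qed (simp add: coef2_def)

text \<open>Up to terms with coefficient 0, both recursions lead to smaller p + q; the first serves
  p > 0, the second p = 0.\<close>

lemma recursive_family_unique:
  assumes P: "recursive_family \<alpha> P" and R: "recursive_family \<alpha> R"
  shows "P = R"
proof -
  have "P p q = R p q" for p q
  proof (induction "p + q" arbitrary: p q rule: less_induct)
    case less
    \<comment> \<open>For k = 0 the truncated k - 1 gives a term with the same index sum as the
      goal, out of reach of the induction hypothesis; its coefficient 0 removes it.\<close>
    have coef0: "coef1 l 0 = 0" "coef2 l r 0 = 0" for l r
      by (simp_all add: coef1_def coef2_def)
    consider (zero) "p = 0" "q = 0" | (left) k where "p = k + 1"
      | (right) k where "p = 0" "q = k + 1"
      by (cases p; cases q) auto
    then show ?case
    proof cases
      case zero
      with P R show ?thesis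
        by (simp add: recursive_family_def)
    next
      case left
      have "P k q = R k q" "k > 0 \<Longrightarrow> P (k - 1) (q + 1) = R (k - 1) (q + 1)"
        "q > 0 \<Longrightarrow> P k (q - 1) = R k (q - 1)"
        using left by (auto intro!: less)
      moreover have "F (k + 1) q = varZ * F k q
              + bconst (coef1 (lam \<alpha>) k) * F (k - 1) (q + 1)
              + bconst (coef2 (lam \<alpha>) k q) * F k (q - 1)" if "recursive_family \<alpha> F" for F
        using that unfolding recursive_family_def by blast
      note this[OF P] this[OF R]
      ultimately show ?thesis
        unfolding left by (cases "k = 0"; cases "q = 0") (simp_all add: coef0 bconst_def)
    next
      case right
      have "P 0 k = R 0 k" "k > 0 \<Longrightarrow> P 1 (k - 1) = R 1 (k - 1)"
        using right by (auto intro!: less)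
      moreover have "F 0 (k + 1) = varZbar * F 0 k
              + bconst (coef1 (lam \<alpha>) k) * F (0 + 1) (k - 1)
              + bconst (coef2 (lam \<alpha>) k 0) * F (0 - 1) k" if "recursive_family \<alpha> F" for F
        using that unfolding recursive_family_def by blast
      note this[OF P] this[OF R]
      ultimately show ?thesis
        unfolding right by (cases "k = 0") (simp_all add: coef0 bconst_def)
    qed
  qed
  then show ?thesis
    by blast
qed

lemma bconst_mult: "bconst a * bconst b = bconst (a * b)"
  by (simp add: bconst_def)

lemma bconst_1: "bconst 1 = 1"
  by (simp add: bconst_def one_pCons)

lemma bconst_mult_left: "bconst a * (bconst b * f) = bconst (a * b) * f"
  by (simp flip: bconst_mult add: mult.assoc)

lemma bconst_0: "bconst 0 = 0"
  by (simp add: bconst_def)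

lemma bconst_minus: "bconst (- a) = - bconst a"
  by (simp add: bconst_def)

definition scaled_char :: "nat \<Rightarrow> nat \<Rightarrow> bipoly" where
  "scaled_char m n = bconst ((1/3) ^ (m + n)) * su3_char (bconst 3 * varZ) (bconst 3 * varZbar) m n"

text \<open>Relative to the left-hand side, the index sum drops by 1 in the \<open>coef1\<close>
  term and by 2 in the \<open>coef2\<close> term, so rescaling turns the coefficients -1 of the
  character recursion into -1/3 and -1/9.\<close>

lemma recursive_family_scaled_char: "recursive_family (1/2) scaled_char"
proof -
  have left: "scaled_char (p + 1) q = varZ * scaled_char p q
      + bconst (coef1 (lam (1/2)) p) * scaled_char (p - 1) (q + 1)
      + bconst (coef2 (lam (1/2)) p q) * scaled_char p (q - 1)" for p q
    unfolding Suc_eq_plus1[symmetric] scaled_char_def su3_char_Suc[of _ _ p q]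
    by (cases p; cases q) (simp_all add: coef1_half coef2_half
        bconst_mult bconst_mult_left bconst_0 bconst_minus algebra_simps)
  have right: "scaled_char p (q + 1) = varZbar * scaled_char p q
      + bconst (coef1 (lam (1/2)) q) * scaled_char (p + 1) (q - 1)
      + bconst (coef2 (lam (1/2)) q p) * scaled_char (p - 1) q" for p q
    unfolding Suc_eq_plus1[symmetric] scaled_char_def su3_char_Suc_right[of _ _ p q]
    by (cases p; cases q) (simp_all add: coef1_half coef2_half
        bconst_mult bconst_mult_left bconst_0 bconst_minus algebra_simps)
  have "scaled_char 0 0 = 1"
    by (simp add: scaled_char_def su3_char_def bconst_1 numeral_2_eq_2)
  moreover from this have "scaled_char 0 1 = varZbar" "scaled_char 1 0 = varZ"
    using left[of 0 0] right[of 0 0] by (simp_all add: coef1_half coef2_half bconst_0)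
  ultimately show ?thesis
    unfolding recursive_family_def using left right by blast
qed

lemma Pfam_half: "Pfam (1/2) = scaled_char"
  unfolding Pfam_def
  using recursive_family_scaled_char recursive_family_unique by blast

theorem proposition8p7:
  shows "\<exists>c :: nat \<Rightarrow> nat \<Rightarrow> real.
           (\<forall>m n. c m n \<noteq> 0) \<and>
           genG = Abs_fps (\<lambda>n. Abs_fps (\<lambda>m. bconst (c m n) * Pfam (1/2) m n))"
proof (intro exI conjI allI)
  \<comment> \<open>The witness cancels the scaling in \<open>scaled_char\<close>.\<close>
  show "(3::real) ^ (m + n) \<noteq> 0" for m n :: nat
    by simp
  show "genG = Abs_fps (\<lambda>n. Abs_fps (\<lambda>m. bconst (3 ^ (m + n)) * Pfam (1/2) m n))"
    by (intro fps_ext) (simp add: genG_nth Pfam_half scaled_char_def bconst_mult_left bconst_1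
        flip: power_mult_distrib)
qed

end
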